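(* Let $Q\subset E$ be convex, $f:Q\to\mathbb{R}$ convex, $L>0$, $\delta_k\ge 0$ and $\widetilde\delta_k\ge0$ for $k\ge 0$, and suppose that for every $k\ge 0$ and every $y\in Q$ there is a $(\delta_k,L)$-model $\psi_{\delta_k}(\cdot,y)$ of $f$ at $y$ with respect to the norm $\|\cdot\|$, with approximate values $f_{\delta_k}(y)$. Let $d$ be $1$-strongly convex on $Q$ w.r.t. $\|\cdot\|$. Let $x_0\in Q$, $0<L_0\le L$, and let $x_*$ be a minimizer of $f$ on $Q$ nearest to $x_0$ in the sense that it minimizes $V[x_0](\cdot)$ among minimizers of $f$; assume $V[x_0](x_* )\le R^2$, and let $f_*=f(x_* )$. Then for the sequences generated by the fast gradient method with inexact auxiliary solutions described in the context and every $N\ge1$, $$f(x_N)-f_*\le\frac{R^2}{A_N}+\frac{2\sum_{k=0}^{N-1}A_{k+1}\delta_k}{A_N}+\frac{\sum_{k=0}^{N-1}\frac{\widetilde\delta_k}{L_{k+1}}}{A_N}\le\frac{8LR^2}{(N+1)^2}+\frac{2\sum_{k=0}^{N-1}A_{k+1}\delta_k}{A_N}+\frac{\sum_{k=0}^{N-1}\frac{\widetilde\delta_k}{L_{k+1}}}{A_N}.$$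
   Context: $E$ is a finite-dimensional real vector space with norm $\|\cdot\|$. $d$ is a convex differentiable function on $Q$ and $V[y](x)=d(x)-d(y)-\langle\nabla d(y),x-y\rangle$. Model. For $\delta\ge 0$, $L>0$, $\psi_\delta(x,y)$ is a $(\delta,L)$-model of $f$ at $y\in Q$ w.r.t. $\|\cdot\|$ if there is $f_\delta(y)\in[f(y)-\delta,f(y)]$ such that for all $x\in Q$ $$0\le f(x)-\bigl(f_\delta(y)+\psi_\delta(x,y)\bigr)\le \tfrac L2\|x-y\|^2+\delta,$$ $\psi_\delta(x,y)$ is convex in $x\in Q$, and $\psi_\delta(x,x)=0$ for all $x\in Q$. Inexact minimizer. For convex $\Psi$ on $Q$ and $\widetilde\delta\ge0$, $\arg\min^{\widetilde\delta}_{x\in Q}\Psi(x)$ denotes some point $\widetilde x\in Q$ for which there exists $h\in\partial\Psi(\widetilde x)$ with $\langle h,x-\widetilde x\rangle\ge-\widetilde\delta$ for all $x\in Q$. Fast gradient method. Put $y_0=u_0=x_0$, $\alpha_0=A_0=0$. For $k=0,1,2,\dots$: find the smallest integer $i_k\ge0$ such that, with $L_{k+1}=2^{i_k-1}L_k$, $\alpha_{k+1}$ the largest root of $A_k+\alpha_{k+1}=L_{k+1}\alpha_{k+1}^2$, $A_{k+1}=A_k+\alpha_{k+1}$, $$y_{k+1}=\frac{\alpha_{k+1}u_k+A_kx_k}{A_{k+1}},\quad u_{k+1}={\arg\min_{x\in Q}}^{\widetilde\delta_k}L_{k+1}\bigl(V[u_k](x)+\alpha_{k+1}\psi_{\delta_k}(x,y_{k+1})\bigr),\quad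 x_{k+1}=\frac{\alpha_{k+1}u_{k+1}+A_kx_k}{A_{k+1}},$$ one has $$f_{\delta_k}(x_{k+1})\le f_{\delta_k}(y_{k+1})+\psi_{\delta_k}(x_{k+1},y_{k+1})+\tfrac{L_{k+1}}2\|x_{k+1}-y_{k+1}\|^2+\delta_k .$$ *)

theory Defs
  imports "HOL-Analysis.Analysis"
begin

text \<open>
  The space is a type of class \<open>real_normed_vector\<close>, so that \<open>norm\<close> is an arbitrary norm;
  the dual space is \<open>'a \<Rightarrow>\<^sub>L real\<close> and the duality pairing is application.
  Functions on \<open>Q\<close> are total functions whose values outside \<open>Q\<close> are never used.
\<close>

definition strongly_convex_on :: "real \<Rightarrow> 'a::real_normed_vector set \<Rightarrow> ('a \<Rightarrow> real) \<Rightarrow> bool" where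
  "strongly_convex_on m Q d \<longleftrightarrow> convex Q \<and>
     (\<forall>x\<in>Q. \<forall>y\<in>Q. \<forall>t\<in>{0..1}.
        d (t *\<^sub>R x + (1 - t) *\<^sub>R y)
          \<le> t * d x + (1 - t) * d y - m / 2 * t * (1 - t) * (norm (x - y))\<^sup>2)"

text \<open>
  \<open>bregman Q d y x\<close> is $V[y](x)$. The derivative within \<open>Q\<close> need not be unique when \<open>Q\<close> has empty
  interior, but its values on differences of points of \<open>Q\<close> are, as the lemma below shows.
\<close>

definition bregman :: "'a::real_normed_vector set \<Rightarrow> ('a \<Rightarrow> real) \<Rightarrow> 'a \<Rightarrow> 'a \<Rightarrow> real" where
  "bregman Q d y x = d x - d y - frechet_derivative d (at y within Q) (x - y)"

lemma bregman_eq: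
  assumes "convex Q" "x \<in> Q" "y \<in> Q" and D: "(d has_derivative D) (at y within Q)"
  shows "bregman Q d y x = d x - d y - D (x - y)"
proof -
  let ?g = "\<lambda>t::real. y + t *\<^sub>R (x - y)"
  have "(1 - t) *\<^sub>R y + t *\<^sub>R x \<in> Q" if "t \<in> {0..1}" for t
    using assms(1-3) that by (simp add: convex_alt)
  moreover have "?g t = (1 - t) *\<^sub>R y + t *\<^sub>R x" for t
    by (simp add: algebra_simps)
  ultimately have sub: "?g ` {0..1} \<subseteq> Q" by auto
  have chain: "((\<lambda>t. d (?g t)) has_vector_derivative D' (x - y)) (at 0 within {0..1})"
    if D': "(d has_derivative D') (at y within Q)" for D'
  proof -
    have "(?g has_derivative (\<lambda>t. t *\<^sub>R (x - y))) (at 0 within {0..1})"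
      by (auto intro!: derivative_eq_intros)
    moreover have "(d has_derivative D') (at (?g 0) within ?g ` {0..1})"
      using has_derivative_subset[OF D' sub] by simp
    ultimately have "((\<lambda>t. d (?g t)) has_derivative (\<lambda>t. D' (t *\<^sub>R (x - y)))) (at 0 within {0..1})"
      by (rule has_derivative_in_compose)
    then show ?thesis
      using linear_scale[OF has_derivative_linear[OF D']]
      by (simp add: has_vector_derivative_def)
  qed
  have "(d has_derivative frechet_derivative d (at y within Q)) (at y within Q)"
    using D frechet_derivative_works differentiable_def by blast
  from vector_derivative_unique_within[OF _ chain[OF this] chain[OF D]]
  show ?thesis
    by (simp add: bregman_def trivial_limit_within)
qed

text \<open>\<open>v\<close> is the approximate value $f_\delta(y)$.\<close>

definition inexact_model ::
  "'a::real_normed_vector set \<Rightarrow> ('a \<Rightarrow> real) \<Rightarrow> real \<Rightarrow> real \<Rightarrow> ('a \<Rightarrow> 'a \<Rightarrow> real) \<Rightarrow> 'a \<Rightarrow> real \<Rightarrow> bool"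
where
  "inexact_model Q f \<delta> L \<psi> y v \<longleftrightarrow>
     v \<in> {f y - \<delta>..f y} \<and>
     (\<forall>x\<in>Q. 0 \<le> f x - (v + \<psi> x y) \<and>
            f x - (v + \<psi> x y) \<le> L / 2 * (norm (x - y))\<^sup>2 + \<delta>) \<and>
     convex_on Q (\<lambda>x. \<psi> x y) \<and>
     (\<forall>x\<in>Q. \<psi> x x = 0)"

text \<open>The subdifferential is that of \<open>\<Psi>\<close> as a function on \<open>Q\<close>.\<close>

definition subdifferential ::
  "'a::real_normed_vector set \<Rightarrow> ('a \<Rightarrow> real) \<Rightarrow> 'a \<Rightarrow> ('a \<Rightarrow>\<^sub>L real) set"
where
  "subdifferential Q \<Psi> x = {h. \<forall>z\<in>Q. \<Psi> z \<ge> \<Psi> x + blinfun_apply h (z - x)}"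

definition inexact_argmin :: "'a::real_normed_vector set \<Rightarrow> real \<Rightarrow> ('a \<Rightarrow> real) \<Rightarrow> 'a set" where
  "inexact_argmin Q \<epsilon> \<Psi> =
     {w \<in> Q. \<exists>h \<in> subdifferential Q \<Psi> w. \<forall>x\<in>Q. blinfun_apply h (x - w) \<ge> - \<epsilon>}"

text \<open>
  One trial of an iteration, with trial constant \<open>L\<close>: it starts from \<open>A\<close>, \<open>x\<close>, \<open>u\<close> and computes
  \<open>\<alpha>\<close>, \<open>A'\<close>, \<open>y\<close>, \<open>u'\<close>, \<open>x'\<close>. It is a relation since \<open>u'\<close> may be any inexact minimizer.
\<close>

definition fgm_trial ::
  "'a::real_normed_vector set \<Rightarrow> ('a \<Rightarrow> real) \<Rightarrow> ('a \<Rightarrow> 'a \<Rightarrow> real) \<Rightarrow> real \<Rightarrow>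
   real \<Rightarrow> 'a \<Rightarrow> 'a \<Rightarrow> real \<Rightarrow> real \<Rightarrow> real \<Rightarrow> 'a \<Rightarrow> 'a \<Rightarrow> 'a \<Rightarrow> bool"
where
  "fgm_trial Q d \<psi> \<epsilon> A x u L \<alpha> A' y u' x' \<longleftrightarrow>
     A + \<alpha> = L * \<alpha>\<^sup>2 \<and> (\<forall>\<beta>. A + \<beta> = L * \<beta>\<^sup>2 \<longrightarrow> \<beta> \<le> \<alpha>) \<and>
     A' = A + \<alpha> \<and>
     y = (\<alpha> *\<^sub>R u + A *\<^sub>R x) /\<^sub>R A' \<and>
     u' \<in> inexact_argmin Q \<epsilon> (\<lambda>z. L * (bregman Q d u z + \<alpha> * \<psi> z y)) \<and>
     x' = (\<alpha> *\<^sub>R u' + A *\<^sub>R x) /\<^sub>R A'"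

definition fgm_accept ::
  "('a::real_normed_vector \<Rightarrow> real) \<Rightarrow> ('a \<Rightarrow> 'a \<Rightarrow> real) \<Rightarrow> real \<Rightarrow> real \<Rightarrow> 'a \<Rightarrow> 'a \<Rightarrow> bool"
where
  "fgm_accept v \<psi> \<delta> L y x \<longleftrightarrow>
     v x \<le> v y + \<psi> x y + L / 2 * (norm (x - y))\<^sup>2 + \<delta>"

text \<open>
  In a run, the trials \<open>j = 0, 1, \<dots>\<close> of iteration \<open>k\<close> are performed in turn, each with an inexact
  minimizer of its own: those with \<open>j < i k\<close> are rejected and the one with \<open>j = i k\<close> is accepted
  and yields the next iterate.
\<close>

definition fgm_run ::
  "'a::real_normed_vector set \<Rightarrow> ('a \<Rightarrow> real) \<Rightarrow> (nat \<Rightarrow> 'a \<Rightarrow> 'a \<Rightarrow> real) \<Rightarrow> (nat \<Rightarrow> 'a \<Rightarrow> real) \<Rightarrow>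
   (nat \<Rightarrow> real) \<Rightarrow> (nat \<Rightarrow> real) \<Rightarrow> 'a \<Rightarrow> real \<Rightarrow>
   (nat \<Rightarrow> nat) \<Rightarrow> (nat \<Rightarrow> real) \<Rightarrow> (nat \<Rightarrow> real) \<Rightarrow> (nat \<Rightarrow> real) \<Rightarrow>
   (nat \<Rightarrow> 'a) \<Rightarrow> (nat \<Rightarrow> 'a) \<Rightarrow> (nat \<Rightarrow> 'a) \<Rightarrow> bool"
where
  "fgm_run Q d \<psi> v \<delta> \<epsilon> x0 L0 i L \<alpha> A y u x \<longleftrightarrow>
     x 0 = x0 \<and> y 0 = x0 \<and> u 0 = x0 \<and> \<alpha> 0 = 0 \<and> A 0 = 0 \<and> L 0 = L0 \<and>
     (\<forall>k. L (Suc k) = 2 powi (int (i k) - 1) * L k \<and>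
          fgm_trial Q d (\<psi> k) (\<epsilon> k) (A k) (x k) (u k) (L (Suc k))
            (\<alpha> (Suc k)) (A (Suc k)) (y (Suc k)) (u (Suc k)) (x (Suc k)) \<and>
          fgm_accept (v k) (\<psi> k) (\<delta> k) (L (Suc k)) (y (Suc k)) (x (Suc k)) \<and>
          (\<forall>j < i k. \<exists>\<alpha>' A' y' u' x'.
             fgm_trial Q d (\<psi> k) (\<epsilon> k) (A k) (x k) (u k) (2 powi (int j - 1) * L k) \<alpha>' A' y' u' x' \<and>
             \<not> fgm_accept (v k) (\<psi> k) (\<delta> k) (2 powi (int j - 1) * L k) y' x'))"

end

theory Submission
  imports Defs
begin

text \<open>
  The subgradient condition defining an inexact minimizer \<open>u'\<close> is tested along segments issuing from
  \<open>u'\<close>; letting the step tend to \<open>0\<close> turns it into the three-point inequality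
  $\alpha\psi(u') + V[u](u') \le \alpha\psi(z) + V[u](z) - V[u'](z) + \widetilde\delta/L'$
  for a trial constant $L'$, with no sum
  rule for subdifferentials. Since $x'-y = (\alpha/A')(u'-u)$ and $A' = L'\alpha^2$, strong convexity
  of \<open>d\<close> gives $(L'/2)\|x'-y\|^2 \le V[u](u')/A'$, so that $A_k(f(x_k)-f_*) + V[u_k](x_*)$ grows in one
  step by at most $2A_{k+1}\delta_k + \widetilde\delta_k/L_{k+1}$. Every trial constant at least \<open>L\<close> is
  accepted; hence $L_k\le 2L$, and $A_{k+1} = L_{k+1}(A_{k+1}-A_k)^2$ forces $A_k\ge(k+1)^2/(8L)$
  for $k\ge1$.
\<close>

section \<open>One-sided derivatives along segments of \<open>Q\<close>\<close>

text \<open>Chain rule along the segment from \<open>w\<close> to \<open>z\<close>. The limit is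
  one-sided because only the parameters between 0 and 1 are known to stay in
  \<open>Q\<close>.\<close>

lemma segment_quotient_tendsto:
  fixes d :: "'a::real_normed_vector \<Rightarrow> real"
  assumes "convex Q" "w \<in> Q" "z \<in> Q" and D: "(d has_derivative D) (at w within Q)"
  shows "((\<lambda>t. (d (w + t *\<^sub>R (z - w)) - d w) / t) \<longlongrightarrow> D (z - w)) (at 0 within {0..1})"
proof -
  let ?g = "\<lambda>t::real. w + t *\<^sub>R (z - w)"
  have "(1 - t) *\<^sub>R w + t *\<^sub>R z \<in> Q" if "t \<in> {0..1}" for t
    using assms(1-3) that by (simp add: convex_alt)
  moreover have "?g t = (1 - t) *\<^sub>R w + t *\<^sub>R z" for t
    by (simp add: algebra_simps)
  ultimately have sub: "?g ` {0..1} \<subseteq> Q" by auto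
  have "(?g has_derivative (\<lambda>t. t *\<^sub>R (z - w))) (at 0 within {0..1})"
    by (auto intro!: derivative_eq_intros)
  moreover have "(d has_derivative D) (at (?g 0) within ?g ` {0..1})"
    using has_derivative_subset[OF D sub] by simp
  ultimately have "((\<lambda>t. d (?g t)) has_derivative (\<lambda>t. D (t *\<^sub>R (z - w)))) (at 0 within {0..1})"
    by (rule has_derivative_in_compose)
  moreover have "(\<lambda>t. D (t *\<^sub>R (z - w))) = (*) (D (z - w))"
    using linear_scale[OF has_derivative_linear[OF D]] by (auto simp: fun_eq_iff)
  ultimately have "((\<lambda>t. d (?g t)) has_field_derivative D (z - w)) (at 0 within {0..1})"
    by (simp add: has_field_derivative_def)
  then show ?thesis
    by (simp add: has_field_derivative_iff)
qed

text \<open>After division by \<open>t\<close> the slack \<open>t * e\<close> vanishes in the limit;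
  it makes room for the factor \<open>1 - t\<close> of strong convexity.\<close>

lemma frechet_derivative_le_of_segment_bound:
  fixes d :: "'a::real_normed_vector \<Rightarrow> real"
  assumes "convex Q" "w \<in> Q" "z \<in> Q" "(d has_derivative D) (at w within Q)"
    and bound: "\<And>t. 0 < t \<Longrightarrow> t \<le> 1 \<Longrightarrow> d (w + t *\<^sub>R (z - w)) - d w \<le> t * (c + t * e)"
  shows "D (z - w) \<le> c"
proof (rule tendsto_le)
  show "((\<lambda>t. (d (w + t *\<^sub>R (z - w)) - d w) / t) \<longlongrightarrow> D (z - w)) (at 0 within {0..1})"
    using assms(1-4) by (rule segment_quotient_tendsto)
  have "((\<lambda>t. c + t * e) \<longlongrightarrow> c + 0 * e) (at 0 within {0..1})"
    by (intro tendsto_intros)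
  then show "((\<lambda>t. c + t * e) \<longlongrightarrow> c) (at 0 within {0..1})" by simp
  show "\<forall>\<^sub>F t in at 0 within {0..1}. (d (w + t *\<^sub>R (z - w)) - d w) / t \<le> c + t * e"
    using bound by (auto simp: eventually_at_filter field_simps)
  show "at (0::real) within {0..1} \<noteq> bot"
    by (simp add: trivial_limit_within)
qed

lemma frechet_derivative_ge_of_segment_bound:
  fixes d :: "'a::real_normed_vector \<Rightarrow> real"
  assumes "convex Q" "w \<in> Q" "z \<in> Q" "(d has_derivative D) (at w within Q)"
    and bound: "\<And>t. 0 < t \<Longrightarrow> t \<le> 1 \<Longrightarrow> t * c \<le> d (w + t *\<^sub>R (z - w)) - d w"
  shows "c \<le> D (z - w)"
proof (rule tendsto_le)
  show "((\<lambda>t. (d (w + t *\<^sub>R (z - w)) - d w) / t) \<longlongrightarrow> D (z - w)) (at 0 within {0..1})"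
    using assms(1-4) by (rule segment_quotient_tendsto)
  show "((\<lambda>t. c) \<longlongrightarrow> c) (at 0 within {0..1::real})" by simp
  show "\<forall>\<^sub>F t in at 0 within {0..1}. c \<le> (d (w + t *\<^sub>R (z - w)) - d w) / t"
    using bound by (auto simp: eventually_at_filter field_simps)
  show "at (0::real) within {0..1} \<noteq> bot"
    by (simp add: trivial_limit_within)
qed

lemma differentiable_on_has_frechet_derivative:
  assumes "d differentiable_on Q" "w \<in> Q"
  shows "(d has_derivative frechet_derivative d (at w within Q)) (at w within Q)"
  using assms frechet_derivative_works by (auto simp: differentiable_on_def)

section \<open>Bregman divergences: quadratic lower bound and inexact minimizers\<close>

lemma bregman_ge_strongly_convex:
  assumes sc: "strongly_convex_on m Q d" and diff: "d differentiable_on Q"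
    and w: "w \<in> Q" and z: "z \<in> Q"
  shows "m / 2 * (norm (z - w))\<^sup>2 \<le> bregman Q d w z"
proof -
  define K where "K = m / 2 * (norm (z - w))\<^sup>2"
  have "frechet_derivative d (at w within Q) (z - w) \<le> d z - d w - K"
  proof (rule frechet_derivative_le_of_segment_bound[OF _ w z])
    show "convex Q" using sc by (simp add: strongly_convex_on_def)
    show "(d has_derivative frechet_derivative d (at w within Q)) (at w within Q)"
      using diff w by (rule differentiable_on_has_frechet_derivative)
    fix t :: real
    assume t: "0 < t" "t \<le> 1"
    then have "d (t *\<^sub>R z + (1 - t) *\<^sub>R w)
        \<le> t * d z + (1 - t) * d w - t * (1 - t) * K"
      using sc[unfolded strongly_convex_on_def, THEN conjunct2, rule_format, OF z w, of t]
      by (simp add: K_def algebra_simps)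
    moreover have "w + t *\<^sub>R (z - w) = t *\<^sub>R z + (1 - t) *\<^sub>R w"
      by (simp add: algebra_simps)
    \<comment> \<open>Here \<open>- (1 - t) * K\<close> is split into \<open>- K\<close>, which
      survives the limit, and the slack \<open>t * K\<close>.\<close>
    ultimately show "d (w + t *\<^sub>R (z - w)) - d w
        \<le> t * (d z - d w - K + t * K)"
      by (simp add: algebra_simps)
  qed
  then show ?thesis by (simp add: bregman_def K_def)
qed

lemma inexact_argmin_three_point:
  assumes Q: "convex Q" and diff: "d differentiable_on Q"
    and u: "u \<in> Q" and z: "z \<in> Q" and \<phi>: "convex_on Q \<phi>"
    and L: "0 < L" and \<alpha>: "0 \<le> \<alpha>"
    and w: "w \<in> inexact_argmin Q \<epsilon> (\<lambda>z. L * (bregman Q d u z + \<alpha> * \<phi> z))"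
  shows "\<alpha> * \<phi> w + bregman Q d u w
    \<le> \<alpha> * \<phi> z + bregman Q d u z - bregman Q d w z + \<epsilon> / L"
proof -
  let ?Du = "frechet_derivative d (at u within Q)"
  let ?Dw = "frechet_derivative d (at w within Q)"
  from w obtain h where wQ: "w \<in> Q"
    and sub: "\<And>z. z \<in> Q \<Longrightarrow> L * (bregman Q d u w + \<alpha> * \<phi> w) + blinfun_apply h (z - w)
      \<le> L * (bregman Q d u z + \<alpha> * \<phi> z)"
    and h: "\<And>z. z \<in> Q \<Longrightarrow> - \<epsilon> \<le> blinfun_apply h (z - w)"
    by (auto simp: inexact_argmin_def subdifferential_def)
  have Du: "(d has_derivative ?Du) (at u within Q)"
    using diff u by (rule differentiable_on_has_frechet_derivative)
  have Dw: "(d has_derivative ?Dw) (at w within Q)"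
    using diff wQ by (rule differentiable_on_has_frechet_derivative)
  note lin = has_derivative_linear[OF Du]
  have Du_z: "?Du (z - u) = ?Du (z - w) + ?Du (w - u)"
    using linear_add[OF lin, of "z - w" "w - u"] by simp
  \<comment> \<open>This is the claim rewritten by the identity V[u](z) - V[u](w) - V[w](z) =
    \<open>?Dw (z - w) - ?Du (z - w)\<close>.\<close>
  have "?Du (z - w) - \<alpha> * (\<phi> z - \<phi> w) - \<epsilon> / L \<le> ?Dw (z - w)"
  proof (rule frechet_derivative_ge_of_segment_bound[OF Q wQ z Dw])
    fix t :: real
    assume t: "0 < t" "t \<le> 1"
    let ?p = "w + t *\<^sub>R (z - w)"
    have p: "?p = (1 - t) *\<^sub>R w + t *\<^sub>R z" by (simp add: algebra_simps)
    then have pQ: "?p \<in> Q"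
      using convexD_alt[OF Q wQ z, of t] t by simp
    have "\<phi> ?p \<le> (1 - t) * \<phi> w + t * \<phi> z"
      unfolding p using convex_onD[OF \<phi>, of t w z] t wQ z by simp
    then have "\<phi> ?p - \<phi> w \<le> t * (\<phi> z - \<phi> w)" by (simp add: algebra_simps)
    then have \<phi>_le: "\<alpha> * (\<phi> ?p - \<phi> w) \<le> \<alpha> * (t * (\<phi> z - \<phi> w))"
      using \<alpha> by (rule mult_left_mono)
    have "?Du (?p - u) = ?Du (w - u) + t * ?Du (z - w)"
      using linear_add[OF lin, of "w - u" "t *\<^sub>R (z - w)"] linear_scale[OF lin, of t "z - w"]
      by (simp add: algebra_simps)
    then have breg: "bregman Q d u ?p - bregman Q d u w = d ?p - d w - t * ?Du (z - w)"
      by (simp add: bregman_def)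
    \<comment> \<open>The condition on \<open>h\<close> is used at \<open>z\<close> and scaled by
      linearity: used at \<open>?p\<close> it would give only \<open>- \<epsilon>\<close>, which
      blows up on division by \<open>t\<close>.\<close>
    have "t * - \<epsilon> \<le> t * blinfun_apply h (z - w)"
      using h[OF z] t by (intro mult_left_mono) auto
    also have "\<dots> = blinfun_apply h (?p - w)"
      by (simp add: blinfun.scaleR_right)
    also have "\<dots> \<le> L * ((bregman Q d u ?p - bregman Q d u w) + \<alpha> * (\<phi> ?p - \<phi> w))"
      using sub[OF pQ] by (simp add: algebra_simps)
    finally have "- (t * \<epsilon> / L)
        \<le> (bregman Q d u ?p - bregman Q d u w) + \<alpha> * (\<phi> ?p - \<phi> w)"
      using L by (simp add: field_simps)
    then show "t * (?Du (z - w) - \<alpha> * (\<phi> z - \<phi> w) - \<epsilon> / L) \<le> d ?p - d w"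
      using \<phi>_le breg by (simp add: algebra_simps)
  qed
  then show ?thesis
    using Du_z by (simp add: bregman_def algebra_simps)
qed

section \<open>One trial and one accepted iteration\<close>

text \<open>The quadratic formula exhibits a positive root, and \<open>\<alpha>\<close> dominates
  it. For \<open>A = 0\<close> this is what excludes the root 0.\<close>

lemma largest_root_pos:
  fixes A L \<alpha> :: real
  assumes "0 < L" "0 \<le> A" and max: "\<And>\<beta>. A + \<beta> = L * \<beta>\<^sup>2 \<Longrightarrow> \<beta> \<le> \<alpha>"
  shows "0 < \<alpha>"
proof -
  define s where "s = sqrt (1 + 4 * L * A)"
  have s: "s\<^sup>2 = 1 + 4 * L * A" "0 \<le> s"
    using assms(1,2) by (auto simp: s_def)
  have "A + (1 + s) / (2 * L) = L * ((1 + s) / (2 * L))\<^sup>2"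
    using s(1) \<open>0 < L\<close> by (simp add: field_simps power2_eq_square)
  then have "(1 + s) / (2 * L) \<le> \<alpha>" by (rule max)
  moreover have "0 < (1 + s) / (2 * L)" using s \<open>0 < L\<close> by simp
  ultimately show ?thesis by linarith
qed

text \<open>The points \<open>y\<close> and \<open>x'\<close> are convex combinations with the same
  weights and the same \<open>x\<close>, so they differ only through \<open>u\<close> and
  \<open>u'\<close>. Acceptance is not involved, so the facts also cover rejected trials.\<close>

lemma fgm_trial_points:
  assumes Q: "convex Q" and "0 < L" "0 \<le> A" and x: "x \<in> Q" and u: "u \<in> Q"
    and trial: "fgm_trial Q d \<psi> \<epsilon> A x u L \<alpha> A' y u' x'"
  shows "0 < \<alpha>" "A' = A + \<alpha>" "0 < A'" "A' = L * \<alpha>\<^sup>2" "y \<in> Q" "u' \<in> Q" "x' \<in> Q"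
    "x' = (\<alpha> / A') *\<^sub>R u' + (A / A') *\<^sub>R x"
    "x' - y = (\<alpha> / A') *\<^sub>R (u' - u)"
proof -
  have root: "A + \<alpha> = L * \<alpha>\<^sup>2" and max: "\<And>\<beta>. A + \<beta> = L * \<beta>\<^sup>2 \<Longrightarrow> \<beta> \<le> \<alpha>"
    and A'_eq: "A' = A + \<alpha>"
    and y_eq: "y = (\<alpha> *\<^sub>R u + A *\<^sub>R x) /\<^sub>R A'"
    and x'_eq: "x' = (\<alpha> *\<^sub>R u' + A *\<^sub>R x) /\<^sub>R A'"
    and argmin: "u' \<in> inexact_argmin Q \<epsilon> (\<lambda>z. L * (bregman Q d u z + \<alpha> * \<psi> z y))"
    using trial unfolding fgm_trial_def by blast+
  show \<alpha>: "0 < \<alpha>"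
    using assms(2,3) max by (rule largest_root_pos)
  show A': "A' = A + \<alpha>" "A' = L * \<alpha>\<^sup>2"
    using root A'_eq by simp_all
  show pos: "0 < A'" using A' \<alpha> assms(3) by simp
  have y: "y = (\<alpha> / A') *\<^sub>R u + (A / A') *\<^sub>R x"
    using y_eq by (simp add: scaleR_add_right divide_inverse mult.commute)
  show x': "x' = (\<alpha> / A') *\<^sub>R u' + (A / A') *\<^sub>R x"
    using x'_eq by (simp add: scaleR_add_right divide_inverse mult.commute)
  show u': "u' \<in> Q"
    using argmin by (simp add: inexact_argmin_def)
  have weights: "\<alpha> / A' \<ge> 0" "A / A' \<ge> 0" "\<alpha> / A' + A / A' = 1"
    using A'(1) pos \<alpha> assms(3) by (auto simp flip: add_divide_distrib)
  show "y \<in> Q" unfolding y using convexD[OF Q u x weights] .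
  show "x' \<in> Q" unfolding x' using convexD[OF Q u' x weights] .
  show "x' - y = (\<alpha> / A') *\<^sub>R (u' - u)"
    unfolding y x' by (simp add: scaleR_diff_right)
qed

text \<open>Since \<open>v x\<close> underestimates \<open>f x\<close>, the upper model bound at
  \<open>y\<close> already is the acceptance test with constant \<open>L\<close>, and a larger
  \<open>M\<close> only weakens it.\<close>

lemma inexact_model_accept:
  assumes x: "x \<in> Q" and "inexact_model Q f \<delta> L \<psi> y (v y)" "inexact_model Q f \<delta> L \<psi> x (v x)"
    and "L \<le> M"
  shows "fgm_accept v \<psi> \<delta> M y x"
proof -
  have "v x \<le> f x" "f x - (v y + \<psi> x y) \<le> L / 2 * (norm (x - y))\<^sup>2 + \<delta>"
    using assms(1-3) by (auto simp: inexact_model_def)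
  moreover have "L / 2 * (norm (x - y))\<^sup>2 \<le> M / 2 * (norm (x - y))\<^sup>2"
    using \<open>L \<le> M\<close> by (intro mult_right_mono) auto
  ultimately show ?thesis by (simp add: fgm_accept_def)
qed

text \<open>One-step decrease of the potential, up to errors. The factor 2 arises because
  \<open>\<delta>\<close> enters once in passing from \<open>f x'\<close> to \<open>v x'\<close> and
  once through the acceptance test.\<close>

lemma fgm_step:
  assumes Q: "convex Q" and diff: "d differentiable_on Q" and sc: "strongly_convex_on 1 Q d"
    and model: "\<And>z. z \<in> Q \<Longrightarrow> inexact_model Q f \<delta> L \<psi> z (v z)"
    and "0 < M" "0 \<le> A" and x: "x \<in> Q" and u: "u \<in> Q" and z: "z \<in> Q"
    and trial: "fgm_trial Q d \<psi> \<epsilon> A x u M \<alpha> A' y u' x'"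
    and acc: "fgm_accept v \<psi> \<delta> M y x'"
  shows "A' * (f x' - f z) + bregman Q d u' z
    \<le> A * (f x - f z) + bregman Q d u z + 2 * (A' * \<delta>) + \<epsilon> / M"
proof -
  note pts = fgm_trial_points[OF Q \<open>0 < M\<close> \<open>0 \<le> A\<close> x u trial]
  let ?n = "norm (u' - u)"
  have conv: "convex_on Q (\<lambda>z. \<psi> z y)"
    using model[OF pts(5)] by (simp add: inexact_model_def)
  have lower: "v y + \<psi> p y \<le> f p" if "p \<in> Q" for p
    using model[OF pts(5)] that by (simp add: inexact_model_def)
  have "f x' \<le> v x' + \<delta>"
    using model[OF pts(7)] by (simp add: inexact_model_def)
  also have "\<dots> \<le> v y + \<psi> x' y + M / 2 * (norm (x' - y))\<^sup>2 + 2 * \<delta>"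
    using acc by (simp add: fgm_accept_def)
  finally have "A' * f x' \<le> A' * (v y + \<psi> x' y + M / 2 * (norm (x' - y))\<^sup>2 + 2 * \<delta>)"
    using pts(3) by (intro mult_left_mono) auto
  then have descent: "A' * f x'
      \<le> A' * v y + A' * \<psi> x' y + A' * (M / 2 * (norm (x' - y))\<^sup>2) + 2 * (A' * \<delta>)"
    by (simp add: algebra_simps)
  have "A' * (M / 2 * (norm (x' - y))\<^sup>2) = (M * \<alpha>\<^sup>2) / A' * (?n\<^sup>2 / 2)"
  proof -
    have "norm (x' - y) = \<alpha> / A' * ?n"
      unfolding pts(9) norm_scaleR using pts(1,3) by simp
    then show ?thesis
      using pts(3) by (simp add: power_mult_distrib power_divide) (simp add: power2_eq_square)
  qed
  \<comment> \<open>The root equation \<open>A' = M * \<alpha>\<^sup>2\<close> makes the quadratic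
    term exactly what 1-strong convexity can pay for.\<close>
  also have "\<dots> = 1 / 2 * ?n\<^sup>2"
    using pts(3) by (simp flip: pts(4))
  also have "\<dots> \<le> bregman Q d u u'"
    using bregman_ge_strongly_convex[OF sc diff u pts(6)] .
  finally have quad: "A' * (M / 2 * (norm (x' - y))\<^sup>2) \<le> bregman Q d u u'" .
  have "\<psi> x' y \<le> \<alpha> / A' * \<psi> u' y + A / A' * \<psi> x y"
  proof -
    have "\<alpha> / A' \<ge> 0" "A / A' \<ge> 0" "\<alpha> / A' + A / A' = 1"
      using pts(1-3) \<open>0 \<le> A\<close> by (auto simp flip: add_divide_distrib)
    with conv pts(6) x show ?thesis
      unfolding pts(8) convex_on_def by blast
  qed
  then have jensen: "A' * \<psi> x' y \<le> \<alpha> * \<psi> u' y + A * \<psi> x y"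
    using pts(3) by (simp add: field_simps)
  have three: "\<alpha> * \<psi> u' y + bregman Q d u u'
      \<le> \<alpha> * \<psi> z y + bregman Q d u z - bregman Q d u' z + \<epsilon> / M"
    using trial pts(1) \<open>0 < M\<close>
    by (intro inexact_argmin_three_point[OF Q diff u z conv]) (auto simp: fgm_trial_def)
  \<comment> \<open>With \<open>A' = A + \<alpha>\<close>, the term \<open>A' * v y\<close> is
    shared between the lower model bounds at \<open>x\<close> and at \<open>z\<close>.\<close>
  have "A * (v y + \<psi> x y) \<le> A * f x"
    using lower[OF x] \<open>0 \<le> A\<close> by (rule mult_left_mono)
  moreover have "\<alpha> * (v y + \<psi> z y) \<le> \<alpha> * f z"
    using lower[OF z] pts(1) by (intro mult_left_mono) auto
  ultimately show ?thesis
    using descent quad jensen three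
    by (simp only: pts(2) distrib_left distrib_right right_diff_distrib)
qed

section \<open>Quadratic growth of the coefficients\<close>

text \<open>With \<open>w = 4 * L * \<alpha>\<close> the root equation yields
  \<open>8 * L * A + 2 * w \<le> w\<^sup>2\<close>. Completing the square gives
  \<open>s + 1 \<le> w\<close>, and then \<open>s\<^sup>2 + 2 * w\<close> is at least
  \<open>(s + 1)\<^sup>2\<close>.\<close>

lemma estimate_coefficient_growth:
  fixes A \<alpha> L M s :: real
  assumes "0 < L" "M \<le> 2 * L" "0 \<le> \<alpha>" "A + \<alpha> = M * \<alpha>\<^sup>2" "1 \<le> s" "s\<^sup>2 / (8 * L) \<le> A"
  shows "(s + 1)\<^sup>2 / (8 * L) \<le> A + \<alpha>"
proof -
  define w where "w = 4 * L * \<alpha>"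
  have "A + \<alpha> \<le> 2 * L * \<alpha>\<^sup>2"
    using assms by (simp add: mult_right_mono)
  then have "8 * L * (A + \<alpha>) \<le> 8 * L * (2 * L * \<alpha>\<^sup>2)"
    using \<open>0 < L\<close> by (intro mult_left_mono) auto
  also have "\<dots> = w\<^sup>2" by (simp add: w_def power2_eq_square)
  finally have "8 * L * A + 2 * w \<le> w\<^sup>2" by (simp add: w_def algebra_simps)
  moreover have sA: "s\<^sup>2 \<le> 8 * L * A"
    using assms(1,6) by (simp add: field_simps)
  ultimately have "s\<^sup>2 \<le> (w - 1)\<^sup>2 - 1" by (simp add: power2_eq_square algebra_simps)
  moreover have "0 \<le> w" using assms by (simp add: w_def)
  ultimately have "s \<le> \<bar>w - 1\<bar>"
    using abs_le_square_iff[of s "w - 1"] \<open>1 \<le> s\<close> by simp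
  \<comment> \<open>The other branch \<open>s \<le> 1 - w\<close> would force \<open>s = 1\<close>
    and \<open>w = 0\<close>; the leftover \<open>- 1\<close> in the square excludes it.\<close>
  moreover have "w \<noteq> 0"
    using \<open>s\<^sup>2 \<le> (w - 1)\<^sup>2 - 1\<close> \<open>1 \<le> s\<close> by auto
  ultimately have "s + 1 \<le> w"
    using \<open>0 \<le> w\<close> \<open>1 \<le> s\<close> by linarith
  then have "(s + 1)\<^sup>2 \<le> 8 * L * (A + \<alpha>)"
    using sA \<open>1 \<le> s\<close> by (simp add: w_def power2_eq_square algebra_simps)
  then show ?thesis using \<open>0 < L\<close> by (simp add: field_simps)
qed

section \<open>Line search, telescoping and the final rate\<close>

theorem theorem19:
  fixes Q :: "'a::real_normed_vector set"
    and f d :: "'a \<Rightarrow> real"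
    and \<psi> :: "nat \<Rightarrow> 'a \<Rightarrow> 'a \<Rightarrow> real"
    and f\<delta> :: "nat \<Rightarrow> 'a \<Rightarrow> real"
    and \<delta> \<delta>' :: "nat \<Rightarrow> real"
    and L L0 R :: real
    and x0 xstar :: 'a
    and i :: "nat \<Rightarrow> nat"
    and Lk \<alpha> A :: "nat \<Rightarrow> real"
    and y u x :: "nat \<Rightarrow> 'a"
    and N :: nat
  assumes "\<exists>B::'a set. finite B \<and> span B = UNIV"
    and "convex Q"
    and "convex_on Q f"
    and "L > 0"
    and "\<And>k. \<delta> k \<ge> 0"
    and "\<And>k. \<delta>' k \<ge> 0"
    and "\<And>k z. z \<in> Q \<Longrightarrow> inexact_model Q f (\<delta> k) L (\<psi> k) z (f\<delta> k z)"
    and "convex_on Q d"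
    and "d differentiable_on Q"
    and "strongly_convex_on 1 Q d"
    and "x0 \<in> Q"
    and "0 < L0" and "L0 \<le> L"
    and "is_arg_min f (\<lambda>z. z \<in> Q) xstar"
    and "is_arg_min (bregman Q d x0) (is_arg_min f (\<lambda>z. z \<in> Q)) xstar"
    and "bregman Q d x0 xstar \<le> R\<^sup>2"
    and "fgm_run Q d \<psi> f\<delta> \<delta> \<delta>' x0 L0 i Lk \<alpha> A y u x"
    and "N \<ge> 1"
  shows "f (x N) - f xstar
           \<le> R\<^sup>2 / A N + 2 * (\<Sum>k<N. A (Suc k) * \<delta> k) / A N + (\<Sum>k<N. \<delta>' k / Lk (Suc k)) / A N
       \<and> R\<^sup>2 / A N + 2 * (\<Sum>k<N. A (Suc k) * \<delta> k) / A N + (\<Sum>k<N. \<delta>' k / Lk (Suc k)) / A N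
           \<le> 8 * L * R\<^sup>2 / (real N + 1)\<^sup>2
             + 2 * (\<Sum>k<N. A (Suc k) * \<delta> k) / A N + (\<Sum>k<N. \<delta>' k / Lk (Suc k)) / A N"
proof -
  note Q = assms(2) and L = assms(4) and model = assms(7) and diff = assms(9) and sc = assms(10)
    and run = assms(17)
  have xsQ: "xstar \<in> Q" using assms(14) by (simp add: is_arg_min_def)
  have trial: "fgm_trial Q d (\<psi> k) (\<delta>' k) (A k) (x k) (u k) (Lk (Suc k))
      (\<alpha> (Suc k)) (A (Suc k)) (y (Suc k)) (u (Suc k)) (x (Suc k))" for k
    using run unfolding fgm_run_def by blast
  have acc: "fgm_accept (f\<delta> k) (\<psi> k) (\<delta> k) (Lk (Suc k)) (y (Suc k)) (x (Suc k))" for k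
    using run unfolding fgm_run_def by blast
  have L_Suc: "Lk (Suc k) = 2 powi (int (i k) - 1) * Lk k" for k
    using run unfolding fgm_run_def by blast
  have init: "x 0 = x0" "u 0 = x0" "A 0 = 0" "Lk 0 = L0"
    using run unfolding fgm_run_def by blast+
  have Lpos: "0 < Lk k" for k
    by (induction k) (use init assms(12) in \<open>auto simp: L_Suc\<close>)
  have inv: "0 \<le> A k \<and> x k \<in> Q \<and> u k \<in> Q" for k
  proof (induction k)
    case 0
    then show ?case using init assms(11) by simp
  next
    case (Suc k)
    then have "0 \<le> A k" "x k \<in> Q" "u k \<in> Q" by auto
    from fgm_trial_points[OF Q Lpos this trial] show ?case by simp
  qed
  then have inv': "0 \<le> A k" "x k \<in> Q" "u k \<in> Q" for k by auto
  note pts = fgm_trial_points[OF Q Lpos inv' trial]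

  \<comment> \<open>If the first trial is accepted, the constant is halved. Otherwise the trial just
    before the accepted one was rejected, so its constant \<open>M\<close> is below \<open>L\<close>
    and the accepted one is \<open>2 * M\<close>.\<close>
  have L_le: "Lk k \<le> 2 * L" for k
  proof (induction k)
    case 0
    then show ?case using init assms(4,13) by simp
  next
    case (Suc k)
    show ?case
    proof (cases "i k")
      case 0
      then show ?thesis using L_Suc[of k] Suc L by (simp add: power_int_minus)
    next
      case (Suc j)
      define M where "M = 2 powi (int j - 1) * Lk k"
      have Mpos: "0 < M" using Lpos by (simp add: M_def)
      have "j < i k" using Suc by simp
      then obtain \<alpha>' A' y' u' x' where
        tr: "fgm_trial Q d (\<psi> k) (\<delta>' k) (A k) (x k) (u k) M \<alpha>' A' y' u' x'"
        and rej: "\<not> fgm_accept (f\<delta> k) (\<psi> k) (\<delta> k) M y' x'"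
        using run unfolding fgm_run_def M_def by blast
      from fgm_trial_points[OF Q Mpos inv' tr] have "x' \<in> Q" "y' \<in> Q" by auto
      then have "M < L"
        using inexact_model_accept[of x' Q f "\<delta> k" L "\<psi> k" y' "f\<delta> k" M] model rej
        by (meson not_le)
      moreover have "Lk (Suc k) = 2 * M"
        using power_int_add[of "2::real" "int j - 1" 1] by (simp add: L_Suc Suc M_def)
      ultimately show ?thesis by simp
    qed
  qed

  \<comment> \<open>The induction starts at \<open>A 1 = 1 / Lk 1\<close>, at least
    \<open>1 / (2 * L)\<close>, since the bound fails for \<open>A 0 = 0\<close>; hence
    \<open>s = real k + 2\<close>.\<close>
  have growth: "(real k + 2)\<^sup>2 / (8 * L) \<le> A (Suc k)" for k
  proof (induction k)
    case 0
    have "A (Suc 0) = \<alpha> (Suc 0)" "\<alpha> (Suc 0) = Lk (Suc 0) * (\<alpha> (Suc 0))\<^sup>2"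
      using pts(2)[of 0] pts(4)[of 0] init by auto
    then have "1 = Lk (Suc 0) * A (Suc 0)"
      using pts(1)[of 0] by (simp add: power2_eq_square)
    also have "\<dots> \<le> 2 * L * A (Suc 0)"
      using L_le pts(3)[of 0] by (intro mult_right_mono) auto
    finally show ?case using L by (simp add: field_simps)
  next
    case (Suc k)
    have "A (Suc k) + \<alpha> (Suc (Suc k)) = Lk (Suc (Suc k)) * (\<alpha> (Suc (Suc k)))\<^sup>2"
      using pts(2)[of "Suc k"] pts(4)[of "Suc k"] by simp
    from estimate_coefficient_growth[OF L L_le less_imp_le[OF pts(1)] this _ Suc]
    show ?case using pts(2)[of "Suc k"] by (simp add: algebra_simps)
  qed

  \<comment> \<open>The one-step estimates telescope; as \<open>A 0 = 0\<close>, the initial gap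
    \<open>f x0 - f xstar\<close> drops out and only the initial divergence remains.\<close>
  have potential: "A n * (f (x n) - f xstar) + bregman Q d (u n) xstar
      \<le> bregman Q d x0 xstar + 2 * (\<Sum>k<n. A (Suc k) * \<delta> k) + (\<Sum>k<n. \<delta>' k / Lk (Suc k))" for n
  proof (induction n)
    case 0
    then show ?case using init by simp
  next
    case (Suc n)
    then show ?case
      using fgm_step[OF Q diff sc model Lpos inv' xsQ trial acc, of n] by simp
  qed

  from \<open>N \<ge> 1\<close> obtain n where N: "N = Suc n" by (cases N) auto
  have AN: "0 < A N" and AN_ge: "(real N + 1)\<^sup>2 / (8 * L) \<le> A N"
    using pts(3)[of n] growth[of n] by (auto simp: N algebra_simps)
  \<comment> \<open>Strong convexity makes the remaining divergence nonnegative, so it can be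
    discarded.\<close>
  have "0 \<le> bregman Q d (u N) xstar"
    by (rule order_trans[OF _ bregman_ge_strongly_convex[OF sc diff inv'(3) xsQ]]) simp
  then have "A N * (f (x N) - f xstar)
      \<le> R\<^sup>2 + 2 * (\<Sum>k<N. A (Suc k) * \<delta> k) + (\<Sum>k<N. \<delta>' k / Lk (Suc k))"
    using potential[of N] assms(16) by linarith
  then have "f (x N) - f xstar
      \<le> (R\<^sup>2 + 2 * (\<Sum>k<N. A (Suc k) * \<delta> k) + (\<Sum>k<N. \<delta>' k / Lk (Suc k))) / A N"
    using AN by (simp add: pos_le_divide_eq mult.commute)
  moreover have "R\<^sup>2 / A N \<le> R\<^sup>2 / ((real N + 1)\<^sup>2 / (8 * L))"
    using AN_ge AN L by (intro divide_left_mono) (auto intro!: mult_pos_pos divide_pos_pos)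
  moreover have "R\<^sup>2 / ((real N + 1)\<^sup>2 / (8 * L)) = 8 * L * R\<^sup>2 / (real N + 1)\<^sup>2"
    by simp
  ultimately show ?thesis
    unfolding add_divide_distrib by linarith
qed

end
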